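(* Let $s \ge 2$ be an integer, let $(U_n)_{n\ge 0}$ be the multibonacci ($s$-bonacci) sequence, and let $X$ be the location of the end (last black cell) of the first black string whose length is of the form $sk+(s-1)$ with $k\ge 0$ an integer, in an infinite board with cells $1,2,3,\ldots$ each coloured black or white independently with probability $1/2$ each. Then the expected value of $X$ is $$\mathbb{E}[X] = \sum_{n \ge s-1} n\,\frac{U_{n-s+2}}{2^{n+1}} = 2^{s+1}-3.$$ In particular, $\mathbb{E}[X]=5$ for $s=2$, $\mathbb{E}[X]=13$ for $s=3$, and $\mathbb{E}[X]=29$ for $s=4$.
   Context: Fix an integer $s\ge 2$. The multibonacci ($s$-bonacci) numbers are defined by $U_0=0$ and, for $n\ge 0$, $U_{n+1}$ is the number of compositions (ordered sums) of $n$ with all parts in $\{1,2,\ldots,s\}$ (so $U_1=1$, from the empty composition of $0$, and $U_2=1$, $U_3=2$). Equivalently, $U_n$ for $n\ge1$ is the number of ways to tile a board of length $n-1$ with $1$-ominoes, $2$-ominoes, $\ldots$, $s$-ominoes; for $n\ge s$ one has $U_{n+1}=U_n+U_{n-1}+\cdots+U_{n-s+1}$. Random model: cells of an infinite board are numbered $1,2,3,\ldots$ and each is independently coloured black or white with probability $1/2$ each. A black string is a maximal run of consecutive black cells (bounded on the right by a white cell, and on the left by a white cell or by the beginning of the board); its length is its number of cells. The random variable $X$ is the index of the last black cell of the first (leftmost) black string whose length equals $sk+(s-1)$ for some integer $k\ge 0$, i.e. whose length is congruent to $s-1$ modulo $s$ (with $X=\infty$ if there is no such string). *)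

theory Defs
  imports "HOL-Probability.Probability"
begin

definition compositions :: "nat \<Rightarrow> nat \<Rightarrow> nat list set" where
  "compositions s n = {ps. set ps \<subseteq> {1..s} \<and> sum_list ps = n}"

fun multibonacci :: "nat \<Rightarrow> nat \<Rightarrow> nat" where
  "multibonacci s 0 = 0"
| "multibonacci s (Suc n) = card (compositions s n)"

text \<open>The cardinality above is never that of an infinite set.\<close>

lemma finite_compositions: "finite (compositions s n)"
proof (rule finite_subset)
  have "length ps \<le> sum_list ps" if "set ps \<subseteq> {1..s}" for ps :: "nat list"
    using that by (induction ps) auto
  then show "compositions s n \<subseteq> {ps. set ps \<subseteq> {1..s} \<and> length ps \<le> n}"
    by (auto simp: compositions_def)
  show "finite {ps. set ps \<subseteq> {1..s} \<and> length ps \<le> n}"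
    by (rule finite_lists_length_le) simp
qed

datatype colour = White | Black

text \<open>A colouring of the board is a function \<open>nat \<Rightarrow> colour\<close> read at the positions
  \<open>1, 2, 3, \<dots>\<close> only; the value at \<open>0\<close> is never used. The maximal run occupying exactly
  the cells \<open>i, \<dots>, j\<close> has a white cell to its right, so an infinite run is not a string.\<close>

definition black_string :: "(nat \<Rightarrow> colour) \<Rightarrow> nat \<Rightarrow> nat \<Rightarrow> bool" where
  "black_string w i j \<longleftrightarrow> 1 \<le> i \<and> i \<le> j \<and> (\<forall>m\<in>{i..j}. w m = Black)
     \<and> w (j + 1) = White \<and> (i = 1 \<or> w (i - 1) = White)"

definition string_ends :: "nat \<Rightarrow> (nat \<Rightarrow> colour) \<Rightarrow> nat set" where
  "string_ends s w =
     {j. \<exists>i. black_string w i j \<and> (\<exists>k. card {i..j} = s * k + (s - 1))}"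

text \<open>Distinct black strings are disjoint, so the leftmost one is the one with the least
  last cell.\<close>

definition first_string_end :: "nat \<Rightarrow> (nat \<Rightarrow> colour) \<Rightarrow> enat" where
  "first_string_end s w =
     (if string_ends s w = {} then \<infinity> else enat (LEAST j. j \<in> string_ends s w))"

end

theory Submission
  imports Defs
begin

text \<open>
  Read a colouring from the left, cutting off a tile of length \<open>i < s\<close> when the first white cell is
  at position \<open>i\<close>, and a tile of length \<open>s\<close> when the first \<open>s\<close> cells are black; stop when the first
  white cell is at position \<open>s\<close>. Cutting off a tile changes the length of the run it meets by a
  multiple of \<open>s\<close>, or removes a run shorter than \<open>s - 1\<close> together with its white cell, so the
  reading stops exactly at the white cell after the first string of length \<open>s - 1\<close> modulo \<open>s\<close>. Hence
  \<open>X = n\<close> is a disjoint union of cylinders on the cells \<open>1, \<dots>, n + 1\<close>, one for each composition of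
  \<open>n + 1 - s\<close>.

  Writing \<open>a k\<close> for the number of compositions of \<open>k\<close> divided by \<open>2 ^ k\<close>, the multibonacci recurrence
  becomes the renewal equation \<open>a k = (\<Sum>i = 1..s. (1 / 2) ^ i * a (k - i))\<close> for \<open>k > 0\<close>
  (with \<open>a\<close> zero at negative arguments), whose weights sum to
  \<open>1 - (1 / 2) ^ s < 1\<close>. This yields both the total mass \<open>1\<close> and the first moment.
\<close>

subsection \<open>Tiling a colouring\<close>

text \<open>Position 0 of the shifted colouring holds cell \<open>d\<close>, but no string condition
  reads it, so the shifted board begins afresh at cell \<open>d + 1\<close>.\<close>

definition shift :: "nat \<Rightarrow> (nat \<Rightarrow> 'b) \<Rightarrow> nat \<Rightarrow> 'b" where
  "shift d w = (\<lambda>m. w (m + d))"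

text \<open>A run starting at cell 1 of the shifted board is bounded on the left by the new
  beginning. On the original board it is maximal only if cell \<open>d\<close> is white, hence the
  second assumption.\<close>

lemma black_string_shift:
  assumes "1 \<le> i" "i = 1 \<longrightarrow> w d = White"
  shows "black_string (shift d w) i j \<longleftrightarrow> black_string w (i + d) (j + d)"
proof -
  have "{i + d..j + d} = (\<lambda>m. m + d) ` {i..j}"
    by simp
  then have "(\<forall>m\<in>{i + d..j + d}. w m = Black) \<longleftrightarrow> (\<forall>m\<in>{i..j}. w (m + d) = Black)"
    by (metis (no_types, lifting) imageE imageI)
  moreover have "i + d - 1 = i - 1 + d"
    using assms by simp
  ultimately show ?thesis
    using assms unfolding black_string_def shift_def by (cases "i = 1") auto
qed

text \<open>A string starting at or before the white cell \<open>i\<close> must end before it. It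
  then has at most \<open>i - 1 < s - 1\<close> cells and cannot count, whatever the colours before
  \<open>i\<close> are. Strings beyond \<open>i\<close> are merely translated.\<close>

lemma string_ends_short_run:
  assumes "1 \<le> i" "i < s" and white: "w i = White"
  shows "string_ends s w = (\<lambda>j. j + i) ` string_ends s (shift i w)"
proof (intro equalityI subsetI)
  fix j assume "j \<in> string_ends s w"
  then obtain h k where h: "black_string w h j" "card {h..j} = s * k + (s - 1)"
    by (auto simp: string_ends_def)
  have "i < h"
  proof (rule ccontr)
    assume "\<not> i < h"
    then have "j < i"
      using h(1) white unfolding black_string_def by (metis atLeastAtMost_iff colour.distinct(1) not_less)
    moreover have "1 \<le> h" "h \<le> j" using h(1) by (auto simp: black_string_def)
    moreover have "card {h..j} \<ge> s - 1" using h(2) by simp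
    ultimately show False using assms by simp
  qed
  moreover have "h \<le> j" using h(1) by (simp add: black_string_def)
  ultimately have "black_string (shift i w) (h - i) (j - i)"
    using h(1) white by (subst black_string_shift) auto
  moreover have "card {h - i..j - i} = s * k + (s - 1)"
    using h(2) \<open>i < h\<close> \<open>h \<le> j\<close> by simp
  ultimately have "j - i \<in> string_ends s (shift i w)"
    by (auto simp: string_ends_def)
  then show "j \<in> (\<lambda>j. j + i) ` string_ends s (shift i w)"
    using \<open>i < h\<close> \<open>h \<le> j\<close> by (intro image_eqI[of _ _ "j - i"]) auto
next
  fix j assume "j \<in> (\<lambda>j. j + i) ` string_ends s (shift i w)"
  then obtain j' h k where h: "j = j' + i" "black_string (shift i w) h j'"
      "card {h..j'} = s * k + (s - 1)"
    by (auto simp: string_ends_def)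
  have "1 \<le> h" using h(2) by (simp add: black_string_def)
  then have "black_string w (h + i) j"
    using h(1,2) white by (simp add: black_string_shift)
  moreover have "card {h + i..j} = s * k + (s - 1)"
    using h by simp
  ultimately show "j \<in> string_ends s w"
    unfolding string_ends_def by blast
qed

text \<open>Only the run starting at cell 1 changes its length, and it loses exactly
  \<open>s\<close> cells, so its residue modulo \<open>s\<close> stays the same.\<close>

lemma string_ends_long_run:
  assumes s: "2 \<le> s" and black: "\<And>m. m \<in> {1..s} \<Longrightarrow> w m = Black"
  shows "string_ends s w = (\<lambda>j. j + s) ` string_ends s (shift s w)"
proof (intro equalityI subsetI)
  fix j assume "j \<in> string_ends s w"
  then obtain h k where h: "black_string w h j" "card {h..j} = s * k + (s - 1)"
    by (auto simp: string_ends_def)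
  have hj: "1 \<le> h" "h \<le> j" using h(1) by (auto simp: black_string_def)
  have "\<exists>h'. black_string (shift s w) h' (j - s) \<and> (\<exists>k. card {h'..j - s} = s * k + (s - 1)) \<and> s \<le> j"
  proof (cases "h = 1")
    case True
    have "s \<le> j"
    proof (rule ccontr)
      assume "\<not> s \<le> j"
      then have "w (j + 1) = Black" using black hj by simp
      then show False using h(1) by (simp add: black_string_def)
    qed
    have len: "j = s * k + (s - 1)" using h(2) True by simp
    \<comment> \<open>With \<open>k = 0\<close> the string would end at \<open>s - 1\<close>, inside
      the black block.\<close>
    have "k \<noteq> 0" using len \<open>s \<le> j\<close> s by (intro notI) simp
    then obtain k' where "k = Suc k'" using not0_implies_Suc by blast
    then have len': "j - s = s * k' + (s - 1)" using len by simp
    \<comment> \<open>Since \<open>s - 1 > 0\<close>, a nonempty part of the run survives the cut; a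
      run of length exactly \<open>s\<close>, which would vanish, is not counted.\<close>
    then have "s < j" using s by simp
    have "black_string (shift s w) 1 (j - s)"
      using h(1) \<open>s < j\<close> True unfolding black_string_def shift_def by auto
    moreover have "card {1..j - s} = s * k' + (s - 1)" using len' by simp
    ultimately show ?thesis using \<open>s \<le> j\<close> by blast
  next
    case False
    then have "w (h - 1) = White" using h(1) by (simp add: black_string_def)
    \<comment> \<open>The white cell before the string lies beyond the black block. So
      \<open>h - s > 1\<close>, and the side condition of \<open>black_string_shift\<close> is
      vacuous even though cell \<open>s\<close> is black.\<close>
    have "s < h - 1"
    proof (rule ccontr)
      assume "\<not> s < h - 1"
      then have "w (h - 1) = Black" using black hj False by simp
      then show False using \<open>w (h - 1) = White\<close> by simp
    qed
    then have "black_string (shift s w) (h - s) (j - s)"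
      using h(1) hj by (subst black_string_shift) auto
    moreover have "card {h - s..j - s} = s * k + (s - 1)"
      using h(2) \<open>s < h - 1\<close> hj by simp
    ultimately show ?thesis using \<open>s < h - 1\<close> hj by (intro exI[of _ "h - s"]) auto
  qed
  then have "j - s \<in> string_ends s (shift s w)" "s \<le> j"
    by (auto simp: string_ends_def)
  then show "j \<in> (\<lambda>j. j + s) ` string_ends s (shift s w)"
    by (intro image_eqI[of _ _ "j - s"]) auto
next
  fix j assume "j \<in> (\<lambda>j. j + s) ` string_ends s (shift s w)"
  then obtain j' h k where h: "j = j' + s" "black_string (shift s w) h j'"
      "card {h..j'} = s * k + (s - 1)"
    by (auto simp: string_ends_def)
  have hj: "1 \<le> h" "h \<le> j'" using h(2) by (auto simp: black_string_def)
  show "j \<in> string_ends s w"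
  proof (cases "h = 1")
    case True
    \<comment> \<open>A string at the start of the shifted board merges with the \<open>s\<close>
      black cells in front of it, which raises its \<open>k\<close> by one.\<close>
    have "w m = Black" if "m \<in> {1..j}" for m
    proof (cases "m \<le> s")
      case False
      then have "m - s \<in> {1..j'}" using that h(1) by auto
      then have "w (m - s + s) = Black"
        using h(2) True by (auto simp: black_string_def shift_def)
      then show ?thesis using False by simp
    qed (use black that in auto)
    moreover have "w (j + 1) = White" using h(1,2) by (simp add: black_string_def shift_def)
    ultimately have "black_string w 1 j"
      using h(1) hj by (simp add: black_string_def)
    moreover have "card {1..j} = s * Suc k + (s - 1)" using h True by simp
    ultimately show ?thesis unfolding string_ends_def by blast
  next
    case False
    then have "black_string w (h + s) j"
      using h(1,2) hj by (simp add: black_string_shift)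
    moreover have "card {h + s..j} = s * k + (s - 1)" using h by simp
    ultimately show ?thesis unfolding string_ends_def by blast
  qed
qed

section \<open>The first end as a least element\<close>

lemma string_ends_ge: "j \<in> string_ends s w \<Longrightarrow> s - 1 \<le> j"
  by (auto simp: string_ends_def black_string_def)

lemma first_string_end_eq_enat_iff:
  "first_string_end s w = enat n \<longleftrightarrow> n \<in> string_ends s w \<and> (\<forall>m\<in>string_ends s w. n \<le> m)"
proof
  assume "first_string_end s w = enat n"
  then have "string_ends s w \<noteq> {}" "n = (LEAST j. j \<in> string_ends s w)"
    by (auto simp: first_string_end_def split: if_splits)
  then show "n \<in> string_ends s w \<and> (\<forall>m\<in>string_ends s w. n \<le> m)"
    by (metis LeastI_ex Least_le ex_in_conv)
next
  assume "n \<in> string_ends s w \<and> (\<forall>m\<in>string_ends s w. n \<le> m)"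
  then show "first_string_end s w = enat n"
    by (auto simp: first_string_end_def intro!: Least_equality)
qed

text \<open>Translating a set translates its minimum; \<open>d \<le> n\<close> guards against
  truncated subtraction.\<close>

lemma first_string_end_shift:
  assumes "string_ends s w = (\<lambda>j. j + d) ` string_ends s (shift d w)"
  shows "first_string_end s w = enat n \<longleftrightarrow>
    d \<le> n \<and> first_string_end s (shift d w) = enat (n - d)"
  unfolding first_string_end_eq_enat_iff assms by force

section \<open>Cylinders of finite words, and the prefix code\<close>

definition agrees :: "(nat \<Rightarrow> 'b) \<Rightarrow> 'b list \<Rightarrow> bool" where
  "agrees w v \<longleftrightarrow> (\<forall>i<length v. w (Suc i) = v ! i)"

lemma agrees_append:
  "agrees w (u @ v) \<longleftrightarrow> agrees w u \<and> agrees (shift (length u) w) v"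
proof
  assume a: "agrees w (u @ v)"
  have "w (Suc i) = u ! i" if "i < length u" for i
    using a that by (auto simp: agrees_def nth_append dest: spec[of _ i])
  moreover have "w (Suc i + length u) = v ! i" if "i < length v" for i
    using a that by (auto simp: agrees_def nth_append add.commute dest: spec[of _ "length u + i"])
  ultimately show "agrees w u \<and> agrees (shift (length u) w) v"
    by (simp add: agrees_def shift_def)
next
  assume a: "agrees w u \<and> agrees (shift (length u) w) v"
  have "w (Suc i) = (u @ v) ! i" if "i < length (u @ v)" for i
  proof (cases "i < length u")
    case False
    then have "w (Suc (i - length u) + length u) = v ! (i - length u)"
      using a that unfolding agrees_def shift_def by (simp del: add_Suc)
    then show ?thesis using False by (simp add: nth_append)
  qed (use a in \<open>auto simp: agrees_def nth_append\<close>)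
  then show "agrees w (u @ v)" by (simp add: agrees_def)
qed

lemma agrees_replicate: "agrees w (replicate n x) \<longleftrightarrow> (\<forall>m\<in>{1..n}. w m = x)"
proof
  assume a: "agrees w (replicate n x)"
  show "\<forall>m\<in>{1..n}. w m = x"
  proof
    fix m assume "m \<in> {1..n}"
    then show "w m = x" using a by (cases m) (auto simp: agrees_def)
  qed
qed (auto simp: agrees_def)

lemma agrees_run:
  "1 \<le> n \<Longrightarrow> agrees w (replicate (n - 1) Black @ [White])
    \<longleftrightarrow> (\<forall>m\<in>{1..<n}. w m = Black) \<and> w n = White"
  by (cases n) (simp_all add: agrees_append agrees_replicate agrees_def[of _ "[White]"] shift_def
    atLeastLessThanSuc_atLeastAtMost)

text \<open>The code words of the parts, together with the terminating word, form a prefix-free code.\<close>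

definition tile :: "nat \<Rightarrow> nat \<Rightarrow> colour list" where
  "tile s i = (if i < s then replicate (i - 1) Black @ [White] else replicate s Black)"

primrec code :: "nat \<Rightarrow> nat list \<Rightarrow> colour list" where
  "code s [] = replicate (s - 1) Black @ [White]"
| "code s (i # is) = tile s i @ code s is"

lemma length_tile: "i \<in> {1..s} \<Longrightarrow> length (tile s i) = i"
  by (auto simp: tile_def)

lemma length_code: "1 \<le> s \<Longrightarrow> set ps \<subseteq> {1..s} \<Longrightarrow> length (code s ps) = sum_list ps + s"
  by (induction ps) (auto simp: length_tile)

lemma agrees_tile:
  "i \<in> {1..s} \<Longrightarrow> agrees w (tile s i) \<longleftrightarrow>
    (if i < s then (\<forall>m\<in>{1..<i}. w m = Black) \<and> w i = White else \<forall>m\<in>{1..s}. w m = Black)"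
  using agrees_run[of i w] by (simp add: tile_def agrees_replicate)

lemma agrees_code_Cons:
  "i \<in> {1..s} \<Longrightarrow> agrees w (code s (i # is)) \<longleftrightarrow>
    agrees w (tile s i) \<and> agrees (shift i w) (code s is)"
  by (simp add: agrees_append length_tile)

section \<open>Decoding a colouring\<close>

lemma string_ends_tile:
  assumes "2 \<le> s" "i \<in> {1..s}" "agrees w (tile s i)"
  shows "string_ends s w = (\<lambda>j. j + i) ` string_ends s (shift i w)"
proof (cases "i < s")
  case True
  then show ?thesis
    using assms by (intro string_ends_short_run) (auto simp: agrees_tile)
next
  case False
  then have "i = s" using assms by simp
  then show ?thesis
    using assms string_ends_long_run[of s w] by (simp add: agrees_tile)
qed

text \<open>Each tile delays the first end by its own length. The terminating word gives a string
  ending at \<open>s - 1\<close>, and nothing can end earlier because counted strings have at least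
  \<open>s - 1\<close> cells.\<close>

lemma first_string_end_code:
  assumes s: "2 \<le> s"
  shows "set ps \<subseteq> {1..s} \<Longrightarrow> agrees w (code s ps) \<Longrightarrow>
    first_string_end s w = enat (sum_list ps + s - 1)"
proof (induction ps arbitrary: w)
  case Nil
  then have run: "\<forall>m\<in>{1..<s}. w m = Black" "w s = White"
    using s agrees_run[of s w] by simp_all
  then have "black_string w 1 (s - 1)"
    using s by (auto simp: black_string_def)
  then have "s - 1 \<in> string_ends s w"
    unfolding string_ends_def using s by (intro CollectI exI[of _ 1] conjI exI[of _ 0]) auto
  then show ?case
    by (auto simp: first_string_end_eq_enat_iff dest: string_ends_ge)
next
  case (Cons i ps)
  then have i: "i \<in> {1..s}" by simp
  then have "agrees w (tile s i)" "agrees (shift i w) (code s ps)"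
    using Cons.prems(2) agrees_code_Cons by blast+
  moreover from this have "first_string_end s (shift i w) = enat (sum_list ps + s - 1)"
    using Cons by simp
  ultimately show ?case
    using first_string_end_shift[OF string_ends_tile[OF s i]] i s by simp
qed

text \<open>Greedy decoding: every colouring starts with a tile or with the terminating word. Tiles
  have positive length, so cutting one off lowers the finite first end, and the decoding
  stops.\<close>

lemma first_string_end_ex_code:
  assumes s: "2 \<le> s"
  shows "first_string_end s w = enat n \<Longrightarrow> \<exists>ps. set ps \<subseteq> {1..s} \<and> agrees w (code s ps)"
proof (induction n arbitrary: w rule: less_induct)
  case (less n)
  have step: ?case if i: "i \<in> {1..s}" and t: "agrees w (tile s i)" for i
  proof -
    have "i \<le> n" "first_string_end s (shift i w) = enat (n - i)"
      using first_string_end_shift[OF string_ends_tile[OF s i t]] less.prems by auto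
    then obtain ps where "set ps \<subseteq> {1..s}" "agrees (shift i w) (code s ps)"
      using less.IH[of "n - i" "shift i w"] i by fastforce
    then show ?case
      using i t agrees_code_Cons[OF i, of w ps] by (intro exI[of _ "i # ps"]) auto
  qed
  show ?case
  proof (cases "\<forall>m\<in>{1..s}. w m = Black")
    case True
    then show ?thesis using s by (intro step[of s]) (auto simp: agrees_tile)
  next
    case False
    then have ex: "\<exists>m. m \<in> {1..s} \<and> w m = White"
      using colour.exhaust by blast
    define i where "i = (LEAST m. m \<in> {1..s} \<and> w m = White)"
    have i: "i \<in> {1..s}" "w i = White" using LeastI_ex[OF ex] by (auto simp: i_def)
    have black: "\<forall>m\<in>{1..<i}. w m = Black"
    proof
      fix m assume "m \<in> {1..<i}"
      then have "w m \<noteq> White"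
        using not_less_Least[of m "\<lambda>m. m \<in> {1..s} \<and> w m = White"] i
        unfolding i_def[symmetric] by simp
      then show "w m = Black" by (cases "w m") auto
    qed
    show ?thesis
    proof (cases "i < s")
      case True
      then show ?thesis using i black by (intro step[of i]) (auto simp: agrees_tile)
    next
      case False
      then have "i = s" using i by simp
      then have "agrees w (code s [])" using i black s agrees_run[of s w] by simp
      then show ?thesis by (intro exI[of _ "[]"]) auto
    qed
  qed
qed

text \<open>The shorter of two different tiles ends in a white cell, where the longer one demands
  black.\<close>

lemma agrees_tile_unique:
  assumes "i \<in> {1..s}" "j \<in> {1..s}" "agrees w (tile s i)" "agrees w (tile s j)"
  shows "i = j"
  using assms
  by (auto simp: agrees_tile split: if_splits)
     (metis atLeastLessThan_iff colour.distinct(1) linorder_neqE_nat)+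

lemma not_agrees_tile_code_Nil:
  assumes "1 \<le> s" "i \<in> {1..s}" "agrees w (tile s i)" "agrees w (code s [])"
  shows False
proof -
  have "\<forall>m\<in>{1..<s}. w m = Black" "w s = White"
    using assms agrees_run[of s w] by simp_all
  then show False
    using assms by (auto simp: agrees_tile split: if_splits)
qed

text \<open>Being prefix-free, the code determines the tiles one after the other. This makes the
  cylinders of different compositions disjoint.\<close>

lemma code_unique:
  assumes s: "1 \<le> s"
  shows "set ps \<subseteq> {1..s} \<Longrightarrow> set qs \<subseteq> {1..s} \<Longrightarrow> agrees w (code s ps) \<Longrightarrow> agrees w (code s qs)
    \<Longrightarrow> ps = qs"
proof (induction ps arbitrary: w qs)
  case Nil
  show ?case
  proof (cases qs)
    case (Cons j qs')
    then have "j \<in> {1..s}" using Nil by simp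
    then show ?thesis
      using Nil Cons agrees_code_Cons not_agrees_tile_code_Nil[OF s] by blast
  qed simp
next
  case (Cons i ps)
  have i: "i \<in> {1..s}" using Cons by simp
  then have a: "agrees w (tile s i)" "agrees (shift i w) (code s ps)"
    using Cons.prems(3) agrees_code_Cons by blast+
  show ?case
  proof (cases qs)
    case Nil
    then show ?thesis using a i Cons.prems(4) not_agrees_tile_code_Nil[OF s] by blast
  next
    case (Cons j qs')
    have j: "j \<in> {1..s}" using Cons Cons.prems by simp
    then have b: "agrees w (tile s j)" "agrees (shift j w) (code s qs')"
      using Cons.prems(4) Cons agrees_code_Cons by blast+
    then have "i = j" using agrees_tile_unique[OF i j] a by simp
    then show ?thesis using Cons.IH[of qs' "shift i w"] Cons.prems Cons a b by simp
  qed
qed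

text \<open>The number \<open>n + 1 - s\<close> solves \<open>n = sum_list ps + s - 1\<close>.
  Without the guard \<open>s - 1 \<le> n\<close> it would truncate to 0 for smaller \<open>n\<close>
  and wrongly admit the empty composition.\<close>

lemma first_string_end_iff_code:
  assumes s: "2 \<le> s"
  shows "first_string_end s w = enat n \<longleftrightarrow>
    s - 1 \<le> n \<and> (\<exists>ps\<in>compositions s (n + 1 - s). agrees w (code s ps))"
proof
  assume e: "first_string_end s w = enat n"
  then obtain ps where ps: "set ps \<subseteq> {1..s}" "agrees w (code s ps)"
    using first_string_end_ex_code[OF s] by blast
  then have "n = sum_list ps + s - 1"
    using first_string_end_code[OF s] e by (metis enat.inject)
  then show "s - 1 \<le> n \<and> (\<exists>ps\<in>compositions s (n + 1 - s). agrees w (code s ps))"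
    using ps s by (auto simp: compositions_def intro!: exI[of _ ps])
next
  assume "s - 1 \<le> n \<and> (\<exists>ps\<in>compositions s (n + 1 - s). agrees w (code s ps))"
  then show "first_string_end s w = enat n"
    using s by (auto simp: compositions_def first_string_end_code)
qed

subsection \<open>Renewal equations\<close>

lemma sums_delay:
  fixes a :: "nat \<Rightarrow> real"
  shows "a sums l \<Longrightarrow> (\<lambda>k. if i \<le> k then a (k - i) else 0) sums l"
  by (subst sums_zero_iff_shift[where n = i, symmetric]) auto

lemma sum_delay_le:
  fixes a :: "nat \<Rightarrow> real"
  assumes "\<And>k. 0 \<le> a k"
  shows "(\<Sum>k<n. if i \<le> k then a (k - i) else 0) \<le> (\<Sum>k<n. a k)"
proof -
  have "(\<Sum>k<n. if i \<le> k then a (k - i) else 0) = (\<Sum>k\<in>{i..<n}. a (k - i))"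
    by (intro sum.mono_neutral_cong_right) auto
  also have "\<dots> = (\<Sum>k<n - i. a k)"
    by (rule sum.reindex_bij_witness[of _ "\<lambda>k. k + i" "\<lambda>k. k - i"]) auto
  also have "\<dots> \<le> (\<Sum>k<n. a k)"
    using assms by (intro sum_mono2) auto
  finally show ?thesis .
qed

text \<open>Delaying a nonnegative sequence does not increase its partial sums, so each partial sum
  S of \<open>a\<close> satisfies S \<le> B + P S, where P < 1 is the total weight. This bounds S;
  summing the equation termwise then gives l = B + P l for the limit.\<close>

lemma renewal_sums:
  fixes a b p :: "nat \<Rightarrow> real"
  assumes p: "\<And>i. i \<in> I \<Longrightarrow> 0 \<le> p i" and p1: "(\<Sum>i\<in>I. p i) < 1"
    and a: "\<And>k. 0 \<le> a k" and b: "b sums B" "\<And>k. 0 \<le> b k"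
    and rec: "\<And>k. a k = b k + (\<Sum>i\<in>I. p i * (if i \<le> k then a (k - i) else 0))"
  shows "a sums (B / (1 - (\<Sum>i\<in>I. p i)))"
proof -
  let ?P = "\<Sum>i\<in>I. p i"
  have "summable a"
  proof (rule summableI_nonneg_bounded[OF a])
    fix n
    have "(\<Sum>k<n. a k) = (\<Sum>k<n. b k) + (\<Sum>k<n. \<Sum>i\<in>I. p i * (if i \<le> k then a (k - i) else 0))"
      by (subst rec) (simp add: sum.distrib)
    also have "(\<Sum>k<n. \<Sum>i\<in>I. p i * (if i \<le> k then a (k - i) else 0))
        = (\<Sum>i\<in>I. p i * (\<Sum>k<n. if i \<le> k then a (k - i) else 0))"
      by (subst sum.swap) (simp add: sum_distrib_left)
    also have "\<dots> \<le> (\<Sum>i\<in>I. p i * (\<Sum>k<n. a k))"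
      by (intro sum_mono mult_left_mono sum_delay_le a p)
    also have "\<dots> = ?P * (\<Sum>k<n. a k)"
      by (simp add: sum_distrib_right)
    also have "(\<Sum>k<n. b k) \<le> B"
      using b sum_le_suminf[of b "{..<n}"] by (auto simp: sums_iff)
    finally have "(1 - ?P) * (\<Sum>k<n. a k) \<le> B"
      by (simp add: algebra_simps)
    then show "(\<Sum>k<n. a k) \<le> B / (1 - ?P)"
      using p1 by (simp add: field_simps)
  qed
  then obtain l where l: "a sums l" by (auto simp: summable_def)
  have "(\<lambda>k. b k + (\<Sum>i\<in>I. p i * (if i \<le> k then a (k - i) else 0))) sums (B + (\<Sum>i\<in>I. p i * l))"
    by (intro sums_add b sums_sum sums_mult sums_delay l)
  then have "a sums (B + (\<Sum>i\<in>I. p i * l))"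
    by (simp only: rec[symmetric])
  with l have "l = B + (\<Sum>i\<in>I. p i * l)"
    by (rule sums_unique2)
  then have "l = B + ?P * l"
    by (simp only: sum_distrib_right)
  then have "(1 - ?P) * l = B"
    by (simp only: left_diff_distrib mult_1_left diff_eq_eq)
  then have "l = B / (1 - ?P)"
    using p1 by (auto simp: field_simps)
  then show ?thesis using l by simp
qed

text \<open>Writing \<open>k = i + (k - i)\<close> shows that \<open>real k * a k\<close> solves a
  renewal equation with the same weights, whose forcing term is summed by the first claim. Solving
  twice produces the squared denominator.\<close>

lemma renewal_sums_weighted:
  fixes a p :: "nat \<Rightarrow> real"
  assumes p: "\<And>i. i \<in> I \<Longrightarrow> 0 \<le> p i" and p1: "(\<Sum>i\<in>I. p i) < 1"
    and a: "\<And>k. 0 \<le> a k"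
    and rec: "\<And>k. a k = (if k = 0 then 1 else 0) + (\<Sum>i\<in>I. p i * (if i \<le> k then a (k - i) else 0))"
  shows "a sums (1 / (1 - (\<Sum>i\<in>I. p i)))"
    and "(\<lambda>k. real k * a k) sums ((\<Sum>i\<in>I. real i * p i) / (1 - (\<Sum>i\<in>I. p i))\<^sup>2)"
proof -
  let ?P = "\<Sum>i\<in>I. p i"
  have b: "(\<lambda>k::nat. if k = 0 then 1 else 0 :: real) sums 1"
    using sums_single[of 0 "\<lambda>_. 1 :: real"] by (simp add: eq_commute)
  show *: "a sums (1 / (1 - ?P))"
    by (rule renewal_sums[OF p p1 a b _ rec]) auto
  \<comment> \<open>The forcing term comes from the summand \<open>i\<close> of
    \<open>k = i + (k - i)\<close>.\<close>
  let ?b = "\<lambda>k. \<Sum>i\<in>I. p i * (real i * (if i \<le> k then a (k - i) else 0))"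
  have "?b sums (\<Sum>i\<in>I. p i * (real i * (1 / (1 - ?P))))"
    by (intro sums_sum sums_mult sums_delay *)
  then have "(\<lambda>k. real k * a k) sums ((\<Sum>i\<in>I. p i * (real i * (1 / (1 - ?P)))) / (1 - ?P))"
  proof (rule renewal_sums[OF p p1, rotated 2])
    fix k
    show "0 \<le> ?b k" using p a by (intro sum_nonneg) auto
    have "real k * a k = (\<Sum>i\<in>I. real k * (p i * (if i \<le> k then a (k - i) else 0)))"
      by (subst rec) (simp add: sum_distrib_left)
    also have "\<dots> = (\<Sum>i\<in>I. p i * (real i * (if i \<le> k then a (k - i) else 0))
        + p i * (if i \<le> k then real (k - i) * a (k - i) else 0))"
      by (intro sum.cong) (auto simp: of_nat_diff algebra_simps)
    finally show "real k * a k = ?b k + (\<Sum>i\<in>I. p i * (if i \<le> k then real (k - i) * a (k - i) else 0))"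
      by (simp add: sum.distrib)
  qed (use a in auto)
  moreover have "(\<Sum>i\<in>I. p i * (real i * (1 / (1 - ?P)))) / (1 - ?P)
      = (\<Sum>i\<in>I. real i * p i) / (1 - ?P)\<^sup>2"
    by (simp add: sum_divide_distrib power2_eq_square mult.commute)
  ultimately show "(\<lambda>k. real k * a k) sums ((\<Sum>i\<in>I. real i * p i) / (1 - ?P)\<^sup>2)"
    by simp
qed

section \<open>Compositions weighted by powers of one half\<close>

lemma sum_half_powers: "(\<Sum>i\<in>{1..s}. (1 / 2) ^ i) = 1 - (1 / 2 :: real) ^ s"
  by (induction s) (auto simp: atLeastAtMostSuc_conv)

lemma sum_mult_half_powers:
  "(\<Sum>i\<in>{1..s}. real i * (1 / 2) ^ i) = 2 - (real s + 2) * (1 / 2) ^ s"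
  by (induction s) (auto simp: atLeastAtMostSuc_conv field_simps)

lemma compositions_0: "compositions s 0 = {[]}"
proof (intro equalityI subsetI)
  fix ps assume "ps \<in> compositions s 0"
  then show "ps \<in> {[]}" by (cases ps) (auto simp: compositions_def)
qed (simp add: compositions_def)

lemma card_compositions_rec:
  assumes "0 < n"
  shows "card (compositions s n) = (\<Sum>i\<in>{1..s}. if i \<le> n then card (compositions s (n - i)) else 0)"
proof -
  \<comment> \<open>Split by the first part, which exists because \<open>n\<close> is positive.
    Parts above \<open>n\<close> are cut away, since \<open>n - i\<close> would truncate to 0 for
    them.\<close>
  have "compositions s n = (\<Union>i\<in>{1..s} \<inter> {..n}. (#) i ` compositions s (n - i))"
  proof (intro equalityI subsetI)
    fix ps assume "ps \<in> compositions s n"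
    then show "ps \<in> (\<Union>i\<in>{1..s} \<inter> {..n}. (#) i ` compositions s (n - i))"
      using assms
      by (cases ps) (force simp: compositions_def intro: bexI[of _ "hd ps"] image_eqI[of _ _ "tl ps"])+
  qed (auto simp: compositions_def)
  then have "card (compositions s n) = (\<Sum>i\<in>{1..s} \<inter> {..n}. card ((#) i ` compositions s (n - i)))"
    by (simp only:) (intro card_UN_disjoint, auto simp: finite_compositions)
  also have "\<dots> = (\<Sum>i\<in>{1..s} \<inter> {..n}. card (compositions s (n - i)))"
    by (simp add: card_image)
  also have "\<dots> = (\<Sum>i\<in>{1..s}. if i \<le> n then card (compositions s (n - i)) else 0)"
    by (subst sum.inter_restrict) auto
  finally show ?thesis .
qed

text \<open>The weights \<open>(1 / 2) ^ i\<close> miss total mass 1 by \<open>(1 / 2) ^ s\<close>.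
  Its inverse is the first sum, and the inverse of its square is the factor \<open>4 ^ s\<close> in
  the second.\<close>

lemma compositions_sums:
  shows "(\<lambda>k. real (card (compositions s k)) / 2 ^ k) sums 2 ^ s"
    and "(\<lambda>k. real k * (real (card (compositions s k)) / 2 ^ k)) sums
      ((2 - (real s + 2) * (1 / 2) ^ s) * 4 ^ s)"
proof -
  let ?a = "\<lambda>k. real (card (compositions s k)) / 2 ^ k"
  have rec: "?a k = (if k = 0 then 1 else 0) + (\<Sum>i\<in>{1..s}. (1 / 2) ^ i * (if i \<le> k then ?a (k - i) else 0))"
    for k
  proof (cases "k = 0")
    case True
    then show ?thesis by (auto simp: compositions_0)
  next
    case False
    then have "?a k = (\<Sum>i\<in>{1..s}. (if i \<le> k then real (card (compositions s (k - i))) else 0) / 2 ^ k)"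
      by (simp add: card_compositions_rec sum_divide_distrib if_distrib[of real] cong: if_cong)
    also have "\<dots> = (\<Sum>i\<in>{1..s}. (1 / 2) ^ i * (if i \<le> k then ?a (k - i) else 0))"
      by (intro sum.cong) (auto simp: power_diff power_divide)
    finally show ?thesis using False by simp
  qed
  have "(\<Sum>i\<in>{1..s}. (1 / 2 :: real) ^ i) < 1"
    unfolding sum_half_powers by simp
  note * = renewal_sums_weighted[OF _ this _ rec, simplified sum_half_powers sum_mult_half_powers]
  show "?a sums 2 ^ s"
    using *(1) by (simp add: power_divide)
  have "((1 / 2 :: real) ^ s)\<^sup>2 = 1 / 4 ^ s"
    by (simp add: power_divide power2_eq_square flip: power_mult_distrib)
  then show "(\<lambda>k. real k * ?a k) sums ((2 - (real s + 2) * (1 / 2) ^ s) * 4 ^ s)"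
    using *(2) by (simp add: divide_simps)
qed

subsection \<open>The distribution of the first string end\<close>

context prob_space
begin

lemma
  fixes c :: "nat \<Rightarrow> 'a \<Rightarrow> colour"
  assumes indep: "indep_vars (\<lambda>_. count_space UNIV) c {1..}"
    and fair: "\<And>n. n \<ge> 1 \<Longrightarrow> prob {\<omega> \<in> space M. c n \<omega> = Black} = 1 / 2"
  shows agrees_in_events: "{\<omega> \<in> space M. agrees (\<lambda>n. c n \<omega>) v} \<in> events" (is ?thesis1)
    and prob_agrees: "prob {\<omega> \<in> space M. agrees (\<lambda>n. c n \<omega>) v} = (1 / 2) ^ length v" (is ?thesis2)
proof -
  have rv: "c n \<in> measurable M (count_space UNIV)" if "1 \<le> n" for n
    using indep that by (auto simp: indep_vars_def)
  have meas: "{\<omega> \<in> space M. c n \<omega> = x} \<in> events" if "1 \<le> n" for n x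
  proof -
    have "{\<omega> \<in> space M. c n \<omega> = x} = c n -` {x} \<inter> space M" by auto
    then show ?thesis using measurable_sets[OF rv[OF that], of "{x}"] by simp
  qed
  have half: "prob {\<omega> \<in> space M. c n \<omega> = x} = 1 / 2" if "1 \<le> n" for n x
  proof (cases x)
    case White
    have "{\<omega> \<in> space M. c n \<omega> = White} = space M - {\<omega> \<in> space M. c n \<omega> = Black}"
      by (auto intro: colour.exhaust)
    then show ?thesis using White prob_compl[OF meas[OF that]] fair[OF that] by simp
  qed (use fair[OF that] in simp)
  have "?thesis1 \<and> ?thesis2"
  \<comment> \<open>The empty word is treated apart: an empty intersection is \<open>UNIV\<close>,
    not \<open>space M\<close>.\<close>
  proof (cases "v = []")
    case True
    then show ?thesis by (simp add: agrees_def prob_space)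
  next
    case False
    define E where "E = (\<lambda>n. {\<omega> \<in> space M. c n \<omega> = v ! (n - 1)})"
    have E: "{\<omega> \<in> space M. agrees (\<lambda>n. c n \<omega>) v} = (\<Inter>n\<in>{1..length v}. E n)"
    proof -
      have "agrees (\<lambda>n. c n \<omega>) v \<longleftrightarrow> (\<forall>n\<in>{1..length v}. c n \<omega> = v ! (n - 1))" for \<omega>
        unfolding agrees_def
        by (auto simp: Suc_le_eq) (metis Suc_pred' diff_less_Suc less_le_trans One_nat_def diff_Suc_1 Suc_le_eq)
      moreover have "1 \<in> {1..length v}" using False by (simp add: Suc_le_eq)
      ultimately show ?thesis unfolding E_def by blast
    qed
    have "E n = c n -` {v ! (n - 1)} \<inter> space M" for n by (auto simp: E_def)
    then have "prob (\<Inter>n\<in>{1..length v}. E n) = (\<Prod>n\<in>{1..length v}. prob (E n))"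
      using False indep_varsD[OF indep, of "{1..length v}" "\<lambda>n. {v ! (n - 1)}"] by (simp add: Suc_le_eq)
    also have "\<dots> = (\<Prod>n\<in>{1..length v}. 1 / 2)"
      by (intro prod.cong) (auto simp: E_def half)
    finally have "prob (\<Inter>n\<in>{1..length v}. E n) = (1 / 2) ^ length v" by simp
    moreover have "(\<Inter>n\<in>{1..length v}. E n) \<in> events"
      using False by (intro sets.finite_INT) (auto simp: E_def meas Suc_le_eq)
    ultimately show ?thesis unfolding E by simp
  qed
  then show ?thesis1 ?thesis2 by auto
qed

lemma
  fixes c :: "nat \<Rightarrow> 'a \<Rightarrow> colour"
  assumes s: "2 \<le> s"
    and indep: "indep_vars (\<lambda>_. count_space UNIV) c {1..}"
    and fair: "\<And>n. n \<ge> 1 \<Longrightarrow> prob {\<omega> \<in> space M. c n \<omega> = Black} = 1 / 2"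
  shows first_string_end_in_events:
      "{\<omega> \<in> space M. first_string_end s (\<lambda>n. c n \<omega>) = enat n} \<in> events" (is "?A \<in> _")
    and prob_first_string_end:
      "prob {\<omega> \<in> space M. first_string_end s (\<lambda>n. c n \<omega>) = enat n} =
        (if s - 1 \<le> n then real (card (compositions s (n + 1 - s))) / 2 ^ (n + 1) else 0)"
proof -
  let ?cyl = "\<lambda>ps. {\<omega> \<in> space M. agrees (\<lambda>n. c n \<omega>) (code s ps)}"
  have "?A \<in> events \<and> prob ?A =
    (if s - 1 \<le> n then real (card (compositions s (n + 1 - s))) / 2 ^ (n + 1) else 0)"
  proof (cases "s - 1 \<le> n")
    case True
    have A: "?A = (\<Union>ps\<in>compositions s (n + 1 - s). ?cyl ps)"
      using True by (auto simp: first_string_end_iff_code[OF s])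
    have cyl: "?cyl ps \<in> events" for ps
      by (rule agrees_in_events[OF indep fair])
    \<comment> \<open>A colouring in two of these cylinders would have two decodings.\<close>
    have "disjoint_family_on ?cyl (compositions s (n + 1 - s))"
      using s code_unique[of s] by (fastforce simp: disjoint_family_on_def compositions_def)
    then have "prob ?A = (\<Sum>ps\<in>compositions s (n + 1 - s). prob (?cyl ps))"
      unfolding A using finite_compositions cyl
      by (intro finite_measure_finite_Union) auto
    also have "\<dots> = (\<Sum>ps\<in>compositions s (n + 1 - s). (1 / 2) ^ (n + 1))"
    proof (rule sum.cong)
      fix ps assume "ps \<in> compositions s (n + 1 - s)"
      \<comment> \<open>All code words involved have the same length, so the sum of their
        probabilities just counts compositions.\<close>
      then have "length (code s ps) = n + 1"
        using True s by (auto simp: compositions_def length_code)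
      then show "prob (?cyl ps) = (1 / 2) ^ (n + 1)"
        by (simp only: prob_agrees[OF indep fair])
    qed simp
    finally have "prob ?A = real (card (compositions s (n + 1 - s))) / 2 ^ (n + 1)"
      by (simp add: power_divide)
    moreover have "?A \<in> events"
      unfolding A using finite_compositions cyl by (intro sets.finite_UN) auto
    ultimately show ?thesis using True by simp
  next
    case False
    then have A: "?A = {}" by (auto simp: first_string_end_iff_code[OF s])
    show ?thesis unfolding A using False by simp
  qed
  then show "?A \<in> events" "prob ?A =
    (if s - 1 \<le> n then real (card (compositions s (n + 1 - s))) / 2 ^ (n + 1) else 0)"
    by auto
qed

end

section \<open>Total mass and expectation\<close>

lemma sums_first_string_end:
  assumes s: "1 \<le> s"
  defines "P \<equiv> \<lambda>n. if s - 1 \<le> n then real (card (compositions s (n + 1 - s))) / 2 ^ (n + 1) else 0"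
  shows "P sums 1" and "(\<lambda>n. real n * P n) sums (2 ^ (s + 1) - 3)"
proof -
  let ?a = "\<lambda>k. real (card (compositions s k)) / 2 ^ k"
  have P: "P (k + (s - 1)) = ?a k / 2 ^ s" for k
    using s by (simp add: P_def power_add)
  have "(\<lambda>k. ?a k / 2 ^ s) sums (2 ^ s / 2 ^ s)"
    by (intro sums_divide compositions_sums)
  then have "(\<lambda>k. P (k + (s - 1))) sums 1" unfolding P by simp
  \<comment> \<open>The omitted initial terms vanish, as \<open>P\<close> is 0 below
    \<open>s - 1\<close>.\<close>
  then show "P sums 1"
    by (subst (asm) sums_zero_iff_shift) (auto simp: P_def)
  have "(\<lambda>k. (real k * ?a k + real (s - 1) * ?a k) / 2 ^ s) sums
      (((2 - (real s + 2) * (1 / 2) ^ s) * 4 ^ s + real (s - 1) * 2 ^ s) / 2 ^ s)"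
    by (intro sums_divide sums_add sums_mult compositions_sums)
  also have "(\<lambda>k. (real k * ?a k + real (s - 1) * ?a k) / 2 ^ s)
      = (\<lambda>k. real (k + (s - 1)) * P (k + (s - 1)))"
    unfolding P by (simp add: field_simps)
  \<comment> \<open>After division the terms containing \<open>s\<close> combine to
    \<open>- (s + 2) + (s - 1) = -3\<close>.\<close>
  also have "((2 - (real s + 2) * (1 / 2) ^ s) * 4 ^ s + real (s - 1) * 2 ^ s) / 2 ^ s
      = (2 ^ (s + 1) - 3 :: real)"
  proof -
    have "(4 :: real) ^ s = 2 ^ s * 2 ^ s" by (simp flip: power_mult_distrib)
    then show ?thesis using s by (simp add: of_nat_diff power_divide field_simps)
  qed
  finally show "(\<lambda>n. real n * P n) sums (2 ^ (s + 1) - 3)"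
    by (subst (asm) sums_zero_iff_shift) (auto simp: P_def)
qed

lemma nn_integral_first_string_end:
  fixes c :: "nat \<Rightarrow> 'a \<Rightarrow> colour"
  assumes s: "2 \<le> s" and M: "prob_space M"
    and indep: "prob_space.indep_vars M (\<lambda>_. count_space UNIV) c {1..}"
    and fair: "\<And>n. n \<ge> 1 \<Longrightarrow> measure M {\<omega> \<in> space M. c n \<omega> = Black} = 1 / 2"
  defines "X \<equiv> \<lambda>\<omega>. ennreal_of_enat (first_string_end s (\<lambda>n. c n \<omega>))"
  shows "X \<in> borel_measurable M" and "(\<integral>\<^sup>+ \<omega>. X \<omega> \<partial>M) = ennreal (2 ^ (s + 1) - 3)"
proof -
  interpret prob_space M by (rule M)
  let ?e = "\<lambda>\<omega>. first_string_end s (\<lambda>n. c n \<omega>)"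
  define E where "E = (\<lambda>n. {\<omega> \<in> space M. ?e \<omega> = enat n})"
  have E: "E n \<in> events" for n
    unfolding E_def by (rule first_string_end_in_events[OF s indep fair])
  have prob_E: "prob (E n) =
      (if s - 1 \<le> n then real (card (compositions s (n + 1 - s))) / 2 ^ (n + 1) else 0)" for n
    unfolding E_def by (rule prob_first_string_end[OF s indep fair])
  \<comment> \<open>As \<open>enat\<close> is countable, measurability can be checked on single
    points; the preimage of infinity is the complement of all \<open>E n\<close>.\<close>
  have "?e -` {x} \<inter> space M \<in> events" for x
  proof (cases x)
    case (enat n)
    then have "?e -` {x} \<inter> space M = E n" by (auto simp: E_def)
    then show ?thesis using E by simp
  next
    case infinity
    then have "?e -` {x} \<inter> space M = space M - (\<Union>n. E n)"
      by (auto simp: E_def)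
    then show ?thesis using E by auto
  qed
  then have e: "?e \<in> measurable M (count_space UNIV)"
    by (subst measurable_count_space_eq_countable) auto
  have "ennreal_of_enat \<in> measurable (count_space UNIV) borel" by simp
  from measurable_compose[OF e this] show X: "X \<in> borel_measurable M"
    by (simp add: X_def)
  have disj: "disjoint_family E"
    by (auto simp: disjoint_family_on_def E_def)
  have "(\<lambda>n. prob (E n)) sums prob (\<Union>n. E n)"
    using E disj by (intro finite_measure_UNION) auto
  moreover have "(\<lambda>n. prob (E n)) sums 1"
    using sums_first_string_end(1)[of s] s unfolding prob_E by simp
  ultimately have "prob (\<Union>n. E n) = 1"
    by (rule sums_unique2)
  moreover have "(\<Union>n. E n) \<in> events" using E by auto
  ultimately have "AE \<omega> in M. \<omega> \<in> (\<Union>n. E n)"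
    using prob_eq_1 by blast
  \<comment> \<open>Total mass 1 makes an infinite first end a null event. The equality fails
    exactly there, because the series is 0 where \<open>X\<close> is infinite.\<close>
  then have "AE \<omega> in M. X \<omega> = (\<Sum>n. ennreal (real n) * indicator (E n) \<omega>)"
  proof eventually_elim
    case (elim \<omega>)
    then obtain n where n: "\<omega> \<in> E n" by auto
    have X_n: "X \<omega> = of_nat n" using n by (simp add: X_def E_def)
    have "(\<Sum>m. ennreal (real m) * indicator (E m) \<omega>)
        = (\<Sum>m\<in>{n}. ennreal (real m) * indicator (E m) \<omega>)"
      using n by (intro suminf_finite) (auto simp: E_def)
    also have "\<dots> = ennreal (real n)" using n by simp
    finally show ?case
      unfolding X_n ennreal_of_nat_eq_real_of_nat by (rule sym)
  qed
  then have "(\<integral>\<^sup>+ \<omega>. X \<omega> \<partial>M) = (\<integral>\<^sup>+ \<omega>. (\<Sum>n. ennreal (real n) * indicator (E n) \<omega>) \<partial>M)"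
    by (rule nn_integral_cong_AE)
  also have "\<dots> = (\<Sum>n. \<integral>\<^sup>+ \<omega>. ennreal (real n) * indicator (E n) \<omega> \<partial>M)"
    using E by (intro nn_integral_suminf) auto
  also have "\<dots> = (\<Sum>n. ennreal (real n * prob (E n)))"
    using E by (simp add: nn_integral_cmult_indicator emeasure_eq_measure ennreal_mult)
  also have "\<dots> = ennreal (2 ^ (s + 1) - 3)"
    using sums_first_string_end(2)[of s] s unfolding prob_E
    by (intro suminf_ennreal_eq) auto
  finally show "(\<integral>\<^sup>+ \<omega>. X \<omega> \<partial>M) = ennreal (2 ^ (s + 1) - 3)" .
qed

theorem theorem2p3:
  fixes s :: nat and M :: "'a measure" and c :: "nat \<Rightarrow> 'a \<Rightarrow> colour"
    and X :: "'a \<Rightarrow> ennreal"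
  assumes s: "s \<ge> 2"
    and M: "prob_space M"
    and indep: "prob_space.indep_vars M (\<lambda>_. count_space UNIV) c {1..}"
    and fair: "\<And>n. n \<ge> 1 \<Longrightarrow> measure M {\<omega> \<in> space M. c n \<omega> = Black} = 1 / 2"
    and X: "X = (\<lambda>\<omega>. ennreal_of_enat (first_string_end s (\<lambda>n. c n \<omega>)))"
  shows "X \<in> borel_measurable M
    \<and> (\<lambda>n. real n * real (multibonacci s (n + 2 - s)) / 2 ^ (n + 1)) summable_on {s - 1..}
    \<and> (\<integral>\<^sup>+ \<omega>. X \<omega> \<partial>M) =
      ennreal (\<Sum>\<^sub>\<infinity>n\<in>{s - 1..}. real n * real (multibonacci s (n + 2 - s)) / 2 ^ (n + 1))
    \<and> ((\<Sum>\<^sub>\<infinity>n\<in>{s - 1..}. real n * real (multibonacci s (n + 2 - s)) / 2 ^ (n + 1))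
      = 2 ^ (s + 1) - 3)
    \<and> (s = 2 \<longrightarrow> (\<integral>\<^sup>+ \<omega>. X \<omega> \<partial>M) = 5)
    \<and> (s = 3 \<longrightarrow> (\<integral>\<^sup>+ \<omega>. X \<omega> \<partial>M) = 13)
    \<and> (s = 4 \<longrightarrow> (\<integral>\<^sup>+ \<omega>. X \<omega> \<partial>M) = 29)"
proof -
  let ?f = "\<lambda>n. real n * real (multibonacci s (n + 2 - s)) / 2 ^ (n + 1)"
  let ?P = "\<lambda>n. if s - 1 \<le> n then real (card (compositions s (n + 1 - s))) / 2 ^ (n + 1) else 0"
  have "((\<lambda>n. real n * ?P n) has_sum (2 ^ (s + 1) - 3)) UNIV"
    using sums_first_string_end(2)[of s] s by (intro sums_nonneg_imp_has_sum) auto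
  \<comment> \<open>The index set shrinks to \<open>{s - 1..}\<close>, outside of which the terms
    are 0. On it \<open>n + 2 - s\<close> is a successor, so \<open>multibonacci\<close> unfolds to
    a number of compositions.\<close>
  also have "?this \<longleftrightarrow> (?f has_sum (2 ^ (s + 1) - 3)) {s - 1..}"
  proof (rule has_sum_cong_neutral)
    fix n assume "n \<in> UNIV \<inter> {s - 1..}"
    then have "n + 2 - s = Suc (n + 1 - s)" using s by auto
    then show "real n * ?P n = ?f n" using \<open>n \<in> UNIV \<inter> {s - 1..}\<close> by simp
  qed auto
  finally have sum: "(?f has_sum (2 ^ (s + 1) - 3)) {s - 1..}" .
  have I: "(\<integral>\<^sup>+ \<omega>. X \<omega> \<partial>M) = ennreal (2 ^ (s + 1) - 3)" and "X \<in> borel_measurable M"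
    unfolding X by (rule nn_integral_first_string_end[OF s M indep fair]; assumption)+
  \<comment> \<open>Summability is recorded because \<open>infsum\<close> takes the default value 0
    on families that are not summable.\<close>
  moreover have "?f summable_on {s - 1..}"
    using sum by (rule has_sum_imp_summable)
  moreover have "infsum ?f {s - 1..} = 2 ^ (s + 1) - 3"
    using sum by (rule infsumI)
  moreover have "(s = 2 \<longrightarrow> (\<integral>\<^sup>+ \<omega>. X \<omega> \<partial>M) = 5) \<and> (s = 3 \<longrightarrow> (\<integral>\<^sup>+ \<omega>. X \<omega> \<partial>M) = 13)
      \<and> (s = 4 \<longrightarrow> (\<integral>\<^sup>+ \<omega>. X \<omega> \<partial>M) = 29)"
    unfolding I by auto
  ultimately show ?thesis by simp
qed

end
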